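(* Let $k\ge 1$ be an integer and let $\gamma_k<2$ be the largest real root of the equation $x^{k+3}-2x^{k+2}+1=0$. Let $G$ be a graph with $n$ vertices, and let $P_1$ be the time complexity of performing steps (1)–(3) of the procedure $\mathsf{BB}$ (defined in the context) once, that is, the reduction step, the termination test and the choice of the branching vertex, without the recursive calls; $P_1$ is polynomial in $n$. Then the time complexity of the algorithm $\mathsf{kDC\text{-}t}$ (defined in the context) on input $(G,k)$ is $\mathcal{O}(P_1\cdot\gamma_k^{n})$, and hence $\mathcal{O}^*(\gamma_k^n)$.
   Context: All graphs are finite, simple, undirected and unweighted. For a graph $g$, $V(g)$ is its vertex set, $d_g(u)$ is the degree of $u$ in $g$, and a non-edge of $g$ is an unordered pair of distinct non-adjacent vertices. For $S\subseteq V(g)$, $\overline{E}(S)$ denotes the set of non-edges of the subgraph of $g$ induced by $S$. A graph is a $k$-defective clique if it has at most $k$ non-edges; a vertex set $S\subseteq V(g)$ is called a $k$-defective clique if $|\overline{E}(S)|\le k$. The maximum $k$-defective clique problem asks, given $G$ and $k$, for a $k$-defective clique $C\subseteq V(G)$ of maximum cardinality. A non-neighbor of $u$ is a vertex different from $u$ and not adjacent to $u$. $S\cup u$ means $S\cup\{u\}$, and $g\setminus b$ is $g$ with the vertex $b$ deleted. The notation $\mathcal{O}^*$ hides factors polynomial in $n$. An instance is a pair $(g,S)$ with $g$ a graph and $S\subseteq V(g)$ a $k$-defective clique. Algorithm $\mathsf{kDC\text{-}t}(G,k)$: set $C^*\leftarrow\emptyset$, run $\mathsf{BB}(G,\emptyset)$,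 and return $C^*$. Procedure $\mathsf{BB}(g,S)$: (1) Exhaustively apply (until neither is applicable) the following two reduction rules to $(g,S)$, giving $(g',S')$. RR1: if $u\in V(g)\setminus S$ satisfies $|\overline{E}(S\cup u)|>k$, delete $u$ from $g$. RR2: if $u\in V(g)\setminus S$ satisfies $|\overline{E}(S\cup u)|\le k$ and $d_g(u)\ge |V(g)|-2$, add $u$ to $S$. (2) If $g'$ is a $k$-defective clique, update $C^*$ by $V(g')$ (that is, replace $C^*$ by $V(g')$ if $V(g')$ is larger) and return. (3) Otherwise choose a branching vertex $b\in V(g')\setminus S'$ that has at least one non-neighbor in $S'$; if no such vertex exists, let $b$ be an arbitrary vertex of $V(g')\setminus S'$. (4) Call $\mathsf{BB}(g',S'\cup b)$ and then $\mathsf{BB}(g'\setminus b,S')$. *)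

theory Defs
  imports Complex_Main "HOL-Library.Landau_Symbols" "Graph_Theory.Digraph"
begin

text \<open>
  Finite simple undirected graphs are the members of the locale \<^locale>\<open>graph\<close>: finite, symmetric,
  without loops and without parallel arcs.  An undirected edge is a pair of opposite arcs, so the
  degree of a vertex is its \<^const>\<open>out_degree\<close>.
\<close>

definition nonedges :: "('a, 'b) pre_digraph \<Rightarrow> 'a set \<Rightarrow> 'a set set" where
  "nonedges g S = {{u, v} | u v. u \<in> S \<and> v \<in> S \<and> u \<noteq> v \<and> \<not> u \<rightarrow>\<^bsub>g\<^esub> v}"

definition defective_clique :: "nat \<Rightarrow> ('a, 'b) pre_digraph \<Rightarrow> 'a set \<Rightarrow> bool" where
  "defective_clique k g S \<longleftrightarrow> S \<subseteq> verts g \<and> card (nonedges g S) \<le> k"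

definition is_defective_clique :: "nat \<Rightarrow> ('a, 'b) pre_digraph \<Rightarrow> bool" where
  "is_defective_clique k g \<longleftrightarrow> defective_clique k g (verts g)"

type_synonym ('a, 'b) inst = "('a, 'b) pre_digraph \<times> 'a set"

definition is_instance :: "nat \<Rightarrow> ('a, 'b) inst \<Rightarrow> bool" where
  "is_instance k = (\<lambda>(g, S). graph g \<and> defective_clique k g S)"


subsection \<open>The procedure BB\<close>

text \<open>In \<open>RR2\<close> the condition \<open>d(u) \<ge> |V| - 2\<close> is written without truncated subtraction.\<close>

inductive reduce :: "nat \<Rightarrow> ('a, 'b) inst \<Rightarrow> ('a, 'b) inst \<Rightarrow> bool" for k :: nat where
  RR1: "\<lbrakk>u \<in> verts g - S; card (nonedges g (S \<union> {u})) > k\<rbrakk>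
    \<Longrightarrow> reduce k (g, S) (pre_digraph.del_vert g u, S)"
| RR2: "\<lbrakk>u \<in> verts g - S; card (nonedges g (S \<union> {u})) \<le> k; card (verts g) \<le> out_degree g u + 2\<rbrakk>
    \<Longrightarrow> reduce k (g, S) (g, S \<union> {u})"

definition reduces_exhaustively :: "nat \<Rightarrow> ('a, 'b) inst \<Rightarrow> ('a, 'b) inst \<Rightarrow> bool" where
  "reduces_exhaustively k I J \<longleftrightarrow> (reduce k)\<^sup>*\<^sup>* I J \<and> (\<nexists>J'. reduce k J J')"

definition has_non_neighbor_in :: "('a, 'b) pre_digraph \<Rightarrow> 'a \<Rightarrow> 'a set \<Rightarrow> bool" where
  "has_non_neighbor_in g u S \<longleftrightarrow> (\<exists>v\<in>S. v \<noteq> u \<and> \<not> u \<rightarrow>\<^bsub>g\<^esub> v)"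

definition branching_vertex :: "('a, 'b) inst \<Rightarrow> 'a \<Rightarrow> bool" where
  "branching_vertex = (\<lambda>(g, S) b. b \<in> verts g - S \<and>
     (has_non_neighbor_in g b S \<or> (\<forall>u \<in> verts g - S. \<not> has_non_neighbor_in g u S)))"

text \<open>
  A configuration consists of the stack of pending calls of BB, the incumbent \<open>C\<^sup>*\<close> and the time
  elapsed so far.  One transition performs steps (1)--(3) for the topmost call and replaces this
  call by its recursive calls (none, if the reduced graph is a defective clique).  All free choices
  of the algorithm (the order in which the reduction rules are applied, the branching vertex) are
  nondeterministic.

  The procedure does not prescribe how steps (1)--(3) are implemented, so their running time is a
  parameter: \<open>cost I t\<close> says that performing steps (1)--(3) once on the instance \<open>I\<close> may take time
  \<open>t\<close>.  It is a relation because the time may also depend on the free choices and on \<open>C\<^sup>*\<close>.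
\<close>

type_synonym ('a, 'b) config = "('a, 'b) inst list \<times> 'a set \<times> nat"

inductive BB_step ::
    "nat \<Rightarrow> (('a, 'b) inst \<Rightarrow> nat \<Rightarrow> bool) \<Rightarrow> ('a, 'b) config \<Rightarrow> ('a, 'b) config \<Rightarrow> bool"
  for k :: nat and cost :: "('a, 'b) inst \<Rightarrow> nat \<Rightarrow> bool" where
  leaf: "\<lbrakk>reduces_exhaustively k I (g', S'); cost I t; is_defective_clique k g'\<rbrakk>
    \<Longrightarrow> BB_step k cost (I # Is, C, T)
          (Is, if card (verts g') > card C then verts g' else C, T + t)"
| branch: "\<lbrakk>reduces_exhaustively k I (g', S'); cost I t; \<not> is_defective_clique k g';
      branching_vertex (g', S') b\<rbrakk>
    \<Longrightarrow> BB_step k cost (I # Is, C, T)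
          ((g', S' \<union> {b}) # (pre_digraph.del_vert g' b, S') # Is, C, T + t)"

text \<open>The configurations reachable when running kDC-t on input \<open>(G, k)\<close>.\<close>

definition kDCt_reaches ::
    "nat \<Rightarrow> (('a, 'b) inst \<Rightarrow> nat \<Rightarrow> bool) \<Rightarrow> ('a, 'b) pre_digraph \<Rightarrow> ('a, 'b) config \<Rightarrow> bool" where
  "kDCt_reaches k cost G c \<longleftrightarrow> (BB_step k cost)\<^sup>*\<^sup>* ([(G, {})], {}, 0) c"


subsection \<open>Time complexity\<close>

text \<open>
  The time complexity of kDC-t, as a function of the number of vertices, lies in the class \<open>F\<close>.
  The bound is imposed on the time elapsed in every reachable configuration, not only in those with
  an empty stack, so that runs that do not terminate are not ignored.
\<close>

definition kDCt_time_in ::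
    "nat \<Rightarrow> (('a, 'b) inst \<Rightarrow> nat \<Rightarrow> bool) \<Rightarrow> (nat \<Rightarrow> real) set \<Rightarrow> bool" where
  "kDCt_time_in k cost F \<longleftrightarrow>
     (\<exists>f\<in>F. \<forall>G Is C T. graph G \<longrightarrow> kDCt_reaches k cost G (Is, C, T) \<longrightarrow> real T \<le> f (card (verts G)))"

text \<open>
  \<open>P n\<close> bounds the time of steps (1)--(3) on every instance with at most \<open>n\<close> vertices; for an input
  graph with \<open>n\<close> vertices these are the sizes that occur in the recursive calls.
\<close>

definition steps_time_bound ::
    "nat \<Rightarrow> (('a, 'b) inst \<Rightarrow> nat \<Rightarrow> bool) \<Rightarrow> (nat \<Rightarrow> real) \<Rightarrow> bool" where
  "steps_time_bound k cost P \<longleftrightarrow>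
     (\<forall>n g S t. is_instance k (g, S) \<longrightarrow> card (verts g) \<le> n \<longrightarrow> cost (g, S) t \<longrightarrow> real t \<le> P n)"

definition polynomially_bounded :: "(nat \<Rightarrow> real) \<Rightarrow> bool" where
  "polynomially_bounded P \<longleftrightarrow> (\<exists>d::nat. P \<in> O(\<lambda>n. real n ^ d))"

definition Ostar :: "(nat \<Rightarrow> real) \<Rightarrow> (nat \<Rightarrow> real) set" where
  "Ostar f = {h. \<exists>d::nat. h \<in> O(\<lambda>n. real n ^ d * f n)}"

text \<open>The set of roots is finite and contains 1, so the maximum exists.\<close>

definition gamma :: "nat \<Rightarrow> real" where
  "gamma k = Max {x::real. x ^ (k + 3) - 2 * x ^ (k + 2) + 1 = 0}"

end

theory Submission
  imports Defs "HOL-Computational_Algebra.Polynomial"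
begin

text \<open>
  Every pending call \<open>(g, S)\<close> carries a charge \<open>2 x c\<^sub>j x\<^sup>m - 1\<close>, where \<open>x\<close> is the growth rate,
  \<open>m = |V(g) - S|\<close>, \<open>j\<close> counts the left branchings since the last reduction or right branching, and
  \<open>c\<^sub>j = x\<^sup>-\<^sup>1 + \<dots>\<close> has \<open>k + 2 - j\<close> terms of a geometric series, so that \<open>x c\<^sub>j = 1 + c\<^sub>j\<^sub>+\<^sub>1\<close> and, by the
  equation for \<open>x\<close>, \<open>c\<^sub>0 = 1\<close>.  A step then never increases the sum of the number of steps taken
  and the charges of the pending calls.  This requires that \<open>j \<le> k\<close> on fully reduced instances.  Indeed,
  a vertex at which RR2 is inapplicable has at least two non-neighbors.  If a branching vertex has a
  non-neighbor in \<open>S\<close>, it adds a non-edge to \<open>S\<close>; if not, all non-neighbors of the \<open>j\<close> vertices added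
  so far lie in \<open>S\<close>, so \<open>S\<close> has at least \<open>j\<close> non-edges already.  Either way \<open>j\<close> left branchings
  produce at least \<open>j - 1\<close> non-edges, and \<open>k + 1\<close> of them force a reduction.
\<close>

section \<open>The growth rate\<close>

lemma
  assumes "k \<ge> 1"
  shows gamma_root: "gamma k ^ (k + 3) - 2 * gamma k ^ (k + 2) + 1 = 0"
    and gamma_gt_1: "gamma k > 1"
    and gamma_less_2: "gamma k < 2"
proof -
  define R where "R = {x::real. x ^ (k + 3) - 2 * x ^ (k + 2) + 1 = 0}"
  let ?p = "monom 1 (k + 3) - monom 2 (k + 2) + 1 :: real poly"
  \<comment> \<open>The value at 2 is 1, so the polynomial is nonzero and has finitely many roots;
    this makes \<open>Max\<close> an actual root.\<close>
  have "poly ?p 2 \<noteq> 0"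
    by (simp add: poly_monom power_add)
  then have "?p \<noteq> 0"
    by (metis poly_0)
  moreover have "R = {x. poly ?p x = 0}"
    by (simp add: R_def poly_monom)
  ultimately have fin: "finite R"
    using poly_roots_finite by metis
  have gamma: "gamma k = Max R"
    by (simp add: gamma_def R_def)
  \<comment> \<open>Since 1 is itself a root, one beyond 1 is needed. At 3/2 the polynomial equals
    \<open>1 - (3/2)^(k+2) / 2\<close>, which is negative; at 2 it equals 1.\<close>
  have "\<exists>x::real. 3 / 2 \<le> x \<and> x \<le> 2 \<and> x ^ (k + 3) - 2 * x ^ (k + 2) + 1 = 0"
  proof (rule IVT')
    have "(3 / 2 :: real) ^ 1 \<le> (3 / 2) ^ k"
      using assms by (intro power_increasing) auto
    then show "(3 / 2 :: real) ^ (k + 3) - 2 * (3 / 2) ^ (k + 2) + 1 \<le> 0"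
      by (simp add: power_add power3_eq_cube power2_eq_square)
  qed (auto intro!: continuous_intros simp: power_add power3_eq_cube power2_eq_square)
  then obtain x where x: "x \<in> R" "3 / 2 \<le> x"
    by (auto simp: R_def)
  have "gamma k \<in> R"
    using Max_in[OF fin] x gamma by (metis empty_iff)
  then show root: "gamma k ^ (k + 3) - 2 * gamma k ^ (k + 2) + 1 = 0"
    by (simp add: R_def)
  have "x \<le> gamma k"
    using fin x gamma by simp
  with x show "gamma k > 1"
    by linarith
  show "gamma k < 2"
  proof (rule ccontr)
    assume "\<not> gamma k < 2"
    then have "gamma k ^ (k + 2) * (gamma k - 2) \<ge> 0"
      by (intro mult_nonneg_nonneg zero_le_power) auto
    moreover have "gamma k ^ (k + 3) = gamma k ^ (k + 2) * gamma k"
      by (simp add: numeral_3_eq_3)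
    ultimately show False
      using root by (simp add: right_diff_distrib)
  qed
qed

text \<open>Level \<open>j\<close> has coefficient \<open>level_weight x (k + 2 - j)\<close>: the
  index counts the remaining terms, so the recurrence is structural.\<close>

definition level_weight :: "real \<Rightarrow> nat \<Rightarrow> real" where
  "level_weight x s = (\<Sum>i<s. (1 / x) ^ Suc i)"

lemma level_weight_Suc:
  assumes "x \<noteq> 0"
  shows "x * level_weight x (Suc s) = 1 + level_weight x s"
  using assms unfolding level_weight_def sum.lessThan_Suc_shift
  by (simp add: distrib_left sum_distrib_left mult.assoc del: power_Suc)
     (simp add: field_simps)

lemma level_weight_eq:
  assumes "x > 1"
  shows "(x - 1) * level_weight x s = 1 - 1 / x ^ s"
proof (induction s)
  case 0
  show ?case by (simp add: level_weight_def)
next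
  case (Suc s)
  have "x * ((x - 1) * level_weight x (Suc s)) = x - 1 + (x - 1) * level_weight x s"
    using level_weight_Suc[of x s] assms by (simp add: algebra_simps)
  also have "\<dots> = x * (1 - 1 / x ^ Suc s)"
    unfolding Suc using assms by (simp add: field_simps)
  finally show ?case
    using assms by simp
qed

text \<open>The equation rearranges to \<open>x ^ (k + 2) * (2 - x) = 1\<close>, which turns the
  closed form of the series into \<open>x - 1\<close>.\<close>

lemma level_weight_gamma:
  assumes "k \<ge> 1"
  shows "level_weight (gamma k) (k + 2) = 1"
proof -
  let ?x = "gamma k"
  have x: "?x > 1"
    using assms by (rule gamma_gt_1)
  have "?x ^ (k + 2) * (2 - ?x) = 1"
    using gamma_root[OF assms] by (simp add: algebra_simps numeral_3_eq_3)
  then have "1 / ?x ^ (k + 2) = 2 - ?x"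
    using x by (simp add: field_simps)
  then have "(?x - 1) * level_weight ?x (k + 2) = ?x - 1"
    using level_weight_eq[OF x, of "k + 2"] by simp
  then show ?thesis
    using x by simp
qed

lemma level_weight_ge:
  assumes "x > 0" "s \<ge> 1"
  shows "level_weight x s \<ge> 1 / x"
proof -
  have "(\<Sum>i\<in>{0}. (1 / x) ^ Suc i) \<le> level_weight x s"
    unfolding level_weight_def using assms by (intro sum_mono2) auto
  then show ?thesis by simp
qed


section \<open>Non-edges\<close>

lemma nonedges_subset_Pow: "nonedges g S \<subseteq> Pow S"
  by (auto simp: nonedges_def)

lemma finite_nonedges: "finite S \<Longrightarrow> finite (nonedges g S)"
  by (meson nonedges_subset_Pow finite_Pow_iff finite_subset)

lemma nonedges_empty [simp]: "nonedges g {} = {}"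
  by (simp add: nonedges_def)

lemma nonedges_mono: "S \<subseteq> S' \<Longrightarrow> nonedges g S \<subseteq> nonedges g S'"
  by (auto simp: nonedges_def)

lemma arcs_ends_del_vert:
  "arcs_ends (pre_digraph.del_vert g u) = {(v, w) \<in> arcs_ends g. v \<noteq> u \<and> w \<noteq> u}"
  by (auto simp: arcs_ends_conv pre_digraph.del_vert_simps)

lemma nonedges_del_vert: "u \<notin> S \<Longrightarrow> nonedges (pre_digraph.del_vert g u) S = nonedges g S"
  unfolding nonedges_def arcs_ends_del_vert by blast

lemma graph_del_vert:
  assumes "graph g"
  shows "graph (pre_digraph.del_vert g u)"
proof -
  interpret graph g by fact
  interpret h: fin_digraph "del_vert u" by (rule fin_digraph_del_vert)
  show ?thesis
  proof
    show "symmetric (del_vert u)"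
      using sym_arcs unfolding symmetric_def arcs_ends_del_vert sym_def by blast
  qed (auto simp: del_vert_simps arc_to_ends_def dest: no_loops intro: no_multi_arcs)
qed

lemma (in graph) card_nonedges_insert:
  assumes "finite S" "b \<notin> S" "has_non_neighbor_in G b S"
  shows "card (nonedges G S) < card (nonedges G (insert b S))"
proof (rule psubset_card_mono)
  show "finite (nonedges G (insert b S))"
    using assms by (simp add: finite_nonedges)
  obtain v where "v \<in> S" "v \<noteq> b" "\<not> b \<rightarrow> v"
    using assms by (auto simp: has_non_neighbor_in_def)
  then have "{b, v} \<in> nonedges G (insert b S)"
    by (auto simp: nonedges_def)
  moreover have "{b, v} \<notin> nonedges G S"
    using nonedges_subset_Pow[of G S] assms by auto
  ultimately show "nonedges G S \<subset> nonedges G (insert b S)"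
    using nonedges_mono[of S "insert b S" G, OF subset_insertI] by (metis psubsetI)
qed

section \<open>Non-neighbors and double counting of non-edges\<close>

definition non_neighbors :: "('a, 'b) pre_digraph \<Rightarrow> 'a \<Rightarrow> 'a set" where
  "non_neighbors g v = {u \<in> verts g. u \<noteq> v \<and> \<not> v \<rightarrow>\<^bsub>g\<^esub> u}"

text \<open>Turns failure of the degree condition of RR2 into two non-neighbors.\<close>

lemma (in graph) card_non_neighbors:
  assumes "v \<in> verts G"
  shows "card (verts G) \<le> out_degree G v + 1 + card (non_neighbors G v)"
proof -
  have "verts G \<subseteq> head G ` out_arcs G v \<union> {v} \<union> non_neighbors G v"
  proof
    fix u assume "u \<in> verts G"
    moreover have "u \<in> head G ` out_arcs G v" if "v \<rightarrow> u"
    proof -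
      from that obtain e where "e \<in> arcs G" "tail G e = v" "head G e = u"
        by (rule reachableE)
      then show ?thesis by (intro rev_image_eqI[of e]) auto
    qed
    ultimately show "u \<in> head G ` out_arcs G v \<union> {v} \<union> non_neighbors G v"
      unfolding non_neighbors_def by blast
  qed
  moreover have fin: "finite (head G ` out_arcs G v)" "finite (non_neighbors G v)"
    by (auto simp: non_neighbors_def)
  ultimately have "card (verts G) \<le> card (head G ` out_arcs G v \<union> {v} \<union> non_neighbors G v)"
    by (intro card_mono) auto
  also have "\<dots> \<le> card (head G ` out_arcs G v) + card {v} + card (non_neighbors G v)"
    by (meson add_le_mono card_Un_le le_trans order_refl)
  also have "\<dots> \<le> out_degree G v + 1 + card (non_neighbors G v)"
    by (simp add: out_degree_def card_image_le finite_out_arcs)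
  finally show ?thesis .
qed

text \<open>Double counting of incidences: each vertex of \<open>B\<close> lies in at least two
  non-edges within \<open>S\<close>, and each non-edge contains at most two vertices of
  \<open>B\<close>.\<close>

lemma card_le_card_nonedges:
  assumes "finite S" "B \<subseteq> S"
    and "\<And>v. v \<in> B \<Longrightarrow> 2 \<le> card (non_neighbors g v)"
    and "\<And>v. v \<in> B \<Longrightarrow> non_neighbors g v \<subseteq> S"
  shows "card B \<le> card (nonedges g S)"
proof -
  let ?E = "nonedges g S"
  have fin: "finite ?E" "finite B"
    using assms finite_subset by (auto intro: finite_nonedges)
  have "2 * card B = (\<Sum>v\<in>B. 2)"
    by simp
  also have "\<dots> \<le> (\<Sum>v\<in>B. card {e \<in> ?E. v \<in> e})"
  proof (rule sum_mono)
    fix v assume v: "v \<in> B"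
    have "(\<lambda>u. {v, u}) ` non_neighbors g v \<subseteq> {e \<in> ?E. v \<in> e}"
      using assms(2) assms(4)[OF v] v by (auto simp: nonedges_def non_neighbors_def)
    moreover have "inj_on (\<lambda>u. {v, u}) (non_neighbors g v)"
      by (auto simp: inj_on_def doubleton_eq_iff)
    ultimately have "card (non_neighbors g v) \<le> card {e \<in> ?E. v \<in> e}"
      using fin by (intro card_inj_on_le[where f = "\<lambda>u. {v, u}"]) simp_all
    with assms(3)[OF v] show "2 \<le> card {e \<in> ?E. v \<in> e}"
      by simp
  qed
  also have "\<dots> = (\<Sum>e\<in>?E. card {v \<in> B. v \<in> e})"
    using fin by (intro sum_multicount_gen[symmetric]) auto
  also have "\<dots> \<le> (\<Sum>e\<in>?E. 2)"
  proof (rule sum_mono)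
    fix e assume "e \<in> ?E"
    then obtain u v where e: "e = {u, v}" "u \<noteq> v"
      by (auto simp: nonedges_def)
    have "card {v \<in> B. v \<in> e} \<le> card e"
      using e by (intro card_mono) auto
    with e show "card {v \<in> B. v \<in> e} \<le> 2"
      by simp
  qed
  finally show ?thesis by simp
qed

text \<open>
  The vertices added to the partial solution by consecutive left branchings without any reduction
  in between form such a set \<open>B\<close>.
\<close>

definition branching_core :: "('a, 'b) pre_digraph \<Rightarrow> 'a set \<Rightarrow> 'a set \<Rightarrow> bool" where
  "branching_core g S B \<longleftrightarrow>
     B \<subseteq> S \<and> (\<forall>v\<in>B. 2 \<le> card (non_neighbors g v)) \<and> card B \<le> Suc (card (nonedges g S))"

lemma branching_core_empty [simp]: "branching_core g S {}"
  by (simp add: branching_core_def)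

lemma is_instance_finite: "is_instance k (g, S) \<Longrightarrow> finite (verts g) \<and> finite S \<and> S \<subseteq> verts g"
  by (auto simp: is_instance_def defective_clique_def graph_def digraph_def
      intro: fin_digraph.finite_verts finite_subset)

lemma card_branching_core_le:
  assumes "is_instance k (g, S)" "branching_core g S B"
  shows "card B \<le> Suc k"
  using assms by (auto simp: is_instance_def defective_clique_def branching_core_def)

text \<open>By symmetry of adjacency, a non-neighbor of some \<open>v\<close> in \<open>B\<close>
  lying outside \<open>S\<close> would have \<open>v\<close> as a non-neighbor in \<open>S\<close>,
  against \<open>sep\<close>. Hence double counting applies.\<close>

lemma card_le_nonedges_if_separated:
  assumes "is_instance k (g, S)" "B \<subseteq> S" "\<And>v. v \<in> B \<Longrightarrow> 2 \<le> card (non_neighbors g v)"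
    and sep: "\<And>u. u \<in> verts g - S \<Longrightarrow> \<not> has_non_neighbor_in g u S"
  shows "card B \<le> card (nonedges g S)"
proof (rule card_le_card_nonedges)
  show "finite S"
    using assms is_instance_finite by blast
  interpret graph g
    using assms by (simp add: is_instance_def)
  fix v assume "v \<in> B"
  with \<open>B \<subseteq> S\<close> have "v \<in> S" by auto
  show "non_neighbors g v \<subseteq> S"
  proof
    fix u assume u: "u \<in> non_neighbors g v"
    then have "\<not> u \<rightarrow>\<^bsub>g\<^esub> v"
      using sym_arcs arcs_ends_symmetric by (fastforce simp: non_neighbors_def)
    with u \<open>v \<in> S\<close> have "has_non_neighbor_in g u S" "u \<in> verts g"
      by (auto simp: non_neighbors_def has_non_neighbor_in_def intro!: bexI[of _ v])
    with sep[of u] show "u \<in> S"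
      by auto
  qed
qed (use assms in auto)

text \<open>
  Otherwise the partial solution \<open>S\<close> has exactly \<open>k\<close> non-edges, so by RR1 no vertex outside has a
  non-neighbor in \<open>S\<close>, and counting the non-edges at \<open>B\<close> yields \<open>k + 1\<close> of them within \<open>S\<close>.
\<close>

lemma card_branching_core_irreducible:
  assumes inst: "is_instance k (g, S)" and core: "branching_core g S B"
    and irred: "\<nexists>J. reduce k (g, S) J"
  shows "card B \<le> k"
proof (rule ccontr)
  assume "\<not> card B \<le> k"
  then have B: "card B = Suc k"
    using card_branching_core_le[OF inst core] by simp
  with core have "k \<le> card (nonedges g S)"
    by (simp add: branching_core_def)
  moreover have "card (nonedges g S) \<le> k"
    using inst by (simp add: is_instance_def defective_clique_def)
  ultimately have k: "card (nonedges g S) = k"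
    by simp
  interpret graph g
    using inst by (simp add: is_instance_def)
  have "\<not> has_non_neighbor_in g u S" if "u \<in> verts g - S" for u
    using card_nonedges_insert[of S u] that irred RR1[of u g S k] is_instance_finite[OF inst] k
    by auto
  then have "card B \<le> card (nonedges g S)"
    using inst core by (intro card_le_nonedges_if_separated) (auto simp: branching_core_def)
  with B k show False by simp
qed


section \<open>Reduction and branching\<close>

lemma reduce_is_instance:
  assumes "reduce k I J" "is_instance k I"
  shows "is_instance k J"
  using assms
proof cases
  case (RR1 u g S)
  then show ?thesis
    using assms(2) by (auto simp: is_instance_def defective_clique_def graph_del_vert
        pre_digraph.verts_del_vert nonedges_del_vert)
next
  case (RR2 u g S)
  then show ?thesis
    using assms(2) by (auto simp: is_instance_def defective_clique_def)
qed

definition open_verts :: "('a, 'b) inst \<Rightarrow> nat" where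
  "open_verts I = card (verts (fst I) - snd I)"

lemma reduce_open_verts:
  assumes "reduce k I J" "is_instance k I"
  shows "open_verts J < open_verts I" "card (verts (fst J)) \<le> card (verts (fst I))"
proof -
  have fin: "finite (verts (fst I))"
    using assms is_instance_finite[of k "fst I" "snd I"] by simp
  have "verts (fst J) - snd J \<subset> verts (fst I) - snd I \<and> verts (fst J) \<subseteq> verts (fst I)"
    using assms(1) by cases (auto simp: pre_digraph.verts_del_vert)
  then show "open_verts J < open_verts I" "card (verts (fst J)) \<le> card (verts (fst I))"
    using fin by (auto simp: open_verts_def intro!: psubset_card_mono card_mono)
qed

text \<open>The last alternative drives the charging: either no rule fired and the core survives, or
  an open vertex is lost, since RR1 deletes one and RR2 moves one into \<open>S\<close>.\<close>

lemma reduces_exhaustively: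
  assumes "reduces_exhaustively k I J" "is_instance k I"
  shows "is_instance k J" "card (verts (fst J)) \<le> card (verts (fst I))"
    "J = I \<or> open_verts J < open_verts I"
proof -
  have "(reduce k)\<^sup>*\<^sup>* I J"
    using assms by (simp add: reduces_exhaustively_def)
  then have "is_instance k J \<and> card (verts (fst J)) \<le> card (verts (fst I)) \<and>
    (J = I \<or> open_verts J < open_verts I)"
  proof induction
    case base
    then show ?case using assms by simp
  next
    case (step J J')
    then show ?case
      using reduce_is_instance[OF step(2)] reduce_open_verts[OF step(2)] by auto
  qed
  then show "is_instance k J" "card (verts (fst J)) \<le> card (verts (fst I))"
    "J = I \<or> open_verts J < open_verts I"
    by auto
qed

lemma branching_core_insert:
  assumes inst: "is_instance k (g, S)" and core: "branching_core g S B"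
    and irred: "\<nexists>J. reduce k (g, S) J" and b: "branching_vertex (g, S) b"
  shows "is_instance k (g, insert b S)" "branching_core g (insert b S) (insert b B)"
    "card (insert b B) = Suc (card B)"
proof -
  interpret graph g
    using inst by (simp add: is_instance_def)
  have fin: "finite S" "S \<subseteq> verts g"
    using is_instance_finite[OF inst] by auto
  have bS: "b \<in> verts g" "b \<notin> S" "b \<notin> B"
    using b core by (auto simp: branching_vertex_def branching_core_def)
  have finB: "finite B"
    using core fin finite_subset by (auto simp: branching_core_def)
  then show card: "card (insert b B) = Suc (card B)"
    using bS by simp
  have le: "card (nonedges g (insert b S)) \<le> k"
    using irred RR1[of b g S k] bS by fastforce
  then show "is_instance k (g, insert b S)"
    using inst bS by (auto simp: is_instance_def defective_clique_def)
  \<comment> \<open>RR2 is inapplicable although \<open>le\<close> meets its bound on non-edges, so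
    its degree condition must fail.\<close>
  have "\<not> card (verts g) \<le> out_degree g b + 2"
    using irred RR2[of b g S k] bS le by auto
  then have b2: "2 \<le> card (non_neighbors g b)"
    using card_non_neighbors[of b] bS by simp
  have mono: "card (nonedges g S) \<le> card (nonedges g (insert b S))"
    using fin by (intro card_mono finite_nonedges nonedges_mono) auto
  \<comment> \<open>This is the size bound of the new core, as \<open>b\<close> adds one to both
    sides. If \<open>b\<close> has no non-neighbor in \<open>S\<close>, the branching rule says that
    no outside vertex has one.\<close>
  have "card B \<le> card (nonedges g (insert b S))"
  proof (cases "has_non_neighbor_in g b S")
    case True
    then show ?thesis
      using card_nonedges_insert[of S b] fin bS core by (simp add: branching_core_def)
  next
    case False
    then have "card B \<le> card (nonedges g S)"
      using inst core b
      by (intro card_le_nonedges_if_separated) (auto simp: branching_core_def branching_vertex_def)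
    with mono show ?thesis by simp
  qed
  then show "branching_core g (insert b S) (insert b B)"
    using core b2 card by (auto simp: branching_core_def)
qed

lemma is_instance_del_vert:
  "is_instance k (g, S) \<Longrightarrow> b \<notin> S \<Longrightarrow> is_instance k (pre_digraph.del_vert g b, S)"
  by (auto simp: is_instance_def defective_clique_def graph_del_vert pre_digraph.verts_del_vert
      nonedges_del_vert)


section \<open>Charging the search tree\<close>

text \<open>The factor \<open>2 * x\<close> keeps the charge at least 1 even for coefficient
  \<open>1 / x\<close> and \<open>m = 0\<close>. The \<open>- 1\<close> balances a branching: the
  children lose 2, the step adds 1, the parent loses 1.\<close>

definition charge :: "nat \<Rightarrow> real \<Rightarrow> nat \<Rightarrow> nat \<Rightarrow> real" where
  "charge k x j m = 2 * x * (level_weight x (k + 2 - j) * x ^ m) - 1"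

lemma charge_ge_1:
  assumes "x > 1" "j \<le> Suc k"
  shows "charge k x j m \<ge> 1"
proof -
  have "1 / x \<le> level_weight x (k + 2 - j)"
    using assms by (intro level_weight_ge) auto
  moreover from this have "0 \<le> level_weight x (k + 2 - j)"
    using assms by (meson order_trans zero_le_divide_1_iff less_imp_le less_trans zero_less_one)
  moreover have "1 \<le> x ^ m"
    using assms by simp
  ultimately have "1 / x * 1 \<le> level_weight x (k + 2 - j) * x ^ m"
    by (intro mult_mono) simp_all
  then have "2 * x * (1 / x * 1) \<le> 2 * x * (level_weight x (k + 2 - j) * x ^ m)"
    using assms by (intro mult_left_mono) auto
  then show ?thesis
    using assms by (simp add: charge_def)
qed

text \<open>Resetting to level 0 raises the coefficient from at least \<open>1 / x\<close> to 1; the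
  lost open vertex pays this factor.\<close>

lemma charge_reduced:
  assumes "x > 1" "level_weight x (k + 2) = 1" "j \<le> Suc k" "m' < m"
  shows "charge k x 0 m' \<le> charge k x j m"
proof -
  have "x ^ m' \<le> x ^ (m - 1)"
    using assms by (intro power_increasing) auto
  also have "\<dots> = 1 / x * x ^ m"
    using assms by (cases m) auto
  also have "\<dots> \<le> level_weight x (k + 2 - j) * x ^ m"
    using assms by (intro mult_right_mono level_weight_ge) auto
  finally show ?thesis
    using assms by (simp add: charge_def)
qed

lemma charge_branch:
  assumes "x > 1" "level_weight x (k + 2) = 1" "j \<le> k" "j' = Suc (j)"
  shows "1 + charge k x j' m + charge k x 0 m = charge k x j (Suc m)"
proof -
  have "k + 2 - j = Suc (k + 2 - j')"
    using assms by simp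
  then have "x * level_weight x (k + 2 - j) = 1 + level_weight x (k + 2 - j')"
    using level_weight_Suc assms by simp
  then have "(x * level_weight x (k + 2 - j)) * x ^ m
    = (1 + level_weight x (k + 2 - j')) * x ^ m"
    by simp
  then have "level_weight x (k + 2 - j) * x ^ Suc m
    = (1 + level_weight x (k + 2 - j')) * x ^ m"
    by (simp only: power_Suc ac_simps)
  then show ?thesis
    using assms by (simp add: charge_def algebra_simps)
qed

text \<open>\<open>B\<close> is existential because an instance does not record its branching
  history. The common \<open>n\<close> lets one time bound serve all calls.\<close>

definition charged :: "nat \<Rightarrow> real \<Rightarrow> nat \<Rightarrow> ('a, 'b) inst \<Rightarrow> real \<Rightarrow> bool" where
  "charged k x n I w \<longleftrightarrow> is_instance k I \<and> card (verts (fst I)) \<le> n \<and>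
     (\<exists>B. branching_core (fst I) (snd I) B \<and> w = charge k x (card B) (open_verts I))"

lemma charged_ge_1:
  assumes "x > 1" "charged k x n I w"
  shows "w \<ge> 1"
  using assms
  by (auto simp: charged_def intro!: charge_ge_1 card_branching_core_le[of k "fst I" "snd I"])

lemma charged_branch:
  assumes x: "x > 1" "level_weight x (k + 2) = 1"
    and ch: "charged k x n I w"
    and red: "reduces_exhaustively k I (g, S)"
    and b: "branching_vertex (g, S) b"
  shows "\<exists>w1 w2. charged k x n (g, S \<union> {b}) w1 \<and>
    charged k x n (pre_digraph.del_vert g b, S) w2 \<and> 1 + w1 + w2 \<le> w"
proof -
  obtain B where B: "branching_core (fst I) (snd I) B" and w: "w = charge k x (card B) (open_verts I)"
    and instI: "is_instance k I" and n: "card (verts (fst I)) \<le> n"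
    using ch by (auto simp: charged_def)
  have inst: "is_instance k (g, S)" and le_n: "card (verts g) \<le> n"
    using reduces_exhaustively[OF red instI] n by auto
  have irred: "\<nexists>J. reduce k (g, S) J"
    using red by (simp add: reduces_exhaustively_def)
  have "\<exists>B'. branching_core g S B' \<and> charge k x (card B') (open_verts (g, S)) \<le> w"
  proof (cases "I = (g, S)")
    case True
    then show ?thesis using B w by auto
  next
    case False
    then have "open_verts (g, S) < open_verts I"
      using reduces_exhaustively(3)[OF red instI] by auto
    then have "charge k x 0 (open_verts (g, S)) \<le> w"
      using charge_reduced x card_branching_core_le[of k "fst I" "snd I" B] instI B w by simp
    then show ?thesis
      by (intro exI[of _ "{}"]) simp
  qed
  then obtain B' where B': "branching_core g S B'" and w': "charge k x (card B') (open_verts (g, S)) \<le> w"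
    by auto
  have bS: "b \<in> verts g - S"
    using b by (simp add: branching_vertex_def)
  have fin: "finite (verts g)"
    using is_instance_finite[OF inst] by simp
  \<comment> \<open>Both children have the same \<open>m\<close> open vertices: \<open>b\<close> is
    either added to \<open>S\<close> or deleted.\<close>
  define m where "m = open_verts (g, S \<union> {b})"
  have diff: "verts g - S = insert b (verts g - (S \<union> {b}))"
    using bS by auto
  have m: "open_verts (g, S) = Suc m"
    unfolding m_def open_verts_def fst_conv snd_conv by (subst diff) (use fin in simp)
  have m': "open_verts (pre_digraph.del_vert g b, S) = m"
    unfolding m_def open_verts_def fst_conv snd_conv pre_digraph.verts_del_vert
    by (rule arg_cong[where f = card]) auto
  note left = branching_core_insert[OF inst B' irred b]
  have "charged k x n (g, S \<union> {b}) (charge k x (card (insert b B')) m)"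
    using left le_n by (auto simp: charged_def m_def)
  moreover have "card (verts (pre_digraph.del_vert g b)) \<le> n"
    using le_n card_Diff1_le[of "verts g" b] by (simp add: pre_digraph.verts_del_vert)
  \<comment> \<open>Deleting \<open>b\<close> may leave core vertices with fewer than two
    non-neighbors, so the right branch restarts with the empty core.\<close>
  then have "charged k x n (pre_digraph.del_vert g b, S) (charge k x 0 m)"
    using is_instance_del_vert[OF inst] bS m' unfolding charged_def
    by (auto intro!: exI[of _ "{}"])
  moreover have "1 + charge k x (card (insert b B')) m + charge k x 0 m \<le> w"
    using charge_branch[OF x card_branching_core_irreducible[OF inst B' irred] left(3)] w' m by simp
  ultimately show ?thesis by blast
qed

section \<open>Running time by a potential argument\<close>

lemma BB_step_charged:
  assumes x: "x > 1" "level_weight x (k + 2) = 1"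
    and cost: "\<And>I t. is_instance k I \<Longrightarrow> card (verts (fst I)) \<le> n \<Longrightarrow> cost I t \<Longrightarrow> real t \<le> p"
    and step: "BB_step k cost (Is, C, T) (Is', C', T')"
    and ch: "list_all2 (charged k x n) Is ws"
  shows "\<exists>ws'. list_all2 (charged k x n) Is' ws' \<and>
    real T' + p * sum_list ws' \<le> real T + p * sum_list ws"
  using step
proof cases
  case (leaf I g' S' t)
  obtain w vs where ws: "ws = w # vs" "charged k x n I w" "list_all2 (charged k x n) Is' vs"
    using ch unfolding leaf(1) by (auto simp: list_all2_Cons1)
  have t: "real t \<le> p"
    using cost[of I t] leaf ws by (auto simp: charged_def)
  \<comment> \<open>The charge of the finished call pays for its time; \<open>p\<close> is
    nonnegative because \<open>0 \<le> t \<le> p\<close>.\<close>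
  have "p * 1 \<le> p * w"
    using charged_ge_1[OF x(1) ws(2)] t by (intro mult_left_mono) auto
  then have "real T' + p * sum_list vs \<le> real T + p * sum_list ws"
    using leaf ws t by (simp add: algebra_simps)
  with ws show ?thesis by blast
next
  case (branch I g' S' t b Js)
  obtain w vs where ws: "ws = w # vs" "charged k x n I w" "list_all2 (charged k x n) Js vs"
    using ch unfolding branch(1) by (auto simp: list_all2_Cons1)
  have t: "real t \<le> p"
    using cost[of I t] branch ws by (auto simp: charged_def)
  obtain w1 w2 where w: "charged k x n (g', S' \<union> {b}) w1"
    "charged k x n (pre_digraph.del_vert g' b, S') w2" "1 + w1 + w2 \<le> w"
    using charged_branch[OF x ws(2)] branch by blast
  have "p * (1 + w1 + w2) \<le> p * w"
    using w(3) t by (intro mult_left_mono) auto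
  then have "real T' + p * sum_list (w1 # w2 # vs) \<le> real T + p * sum_list ws"
    using branch ws t by (simp add: algebra_simps)
  moreover have "list_all2 (charged k x n) Is' (w1 # w2 # vs)"
    using branch w ws by simp
  ultimately show ?thesis by blast
qed

lemma kDCt_time_le:
  assumes x: "x > 1" "level_weight x (k + 2) = 1"
    and G: "graph G" and p: "p \<ge> 0"
    and cost: "\<And>I t. is_instance k I \<Longrightarrow> card (verts (fst I)) \<le> card (verts G) \<Longrightarrow>
      cost I t \<Longrightarrow> real t \<le> p"
    and reach: "kDCt_reaches k cost G (Is, C, T)"
  shows "real T \<le> 2 * x * (p * x ^ card (verts G))"
proof -
  let ?n = "card (verts G)"
  let ?w = "charge k x 0 (open_verts (G, {}))"
  have "\<exists>ws. list_all2 (charged k x ?n) Js ws \<and> real U + p * sum_list ws \<le> p * ?w"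
    if "(BB_step k cost)\<^sup>*\<^sup>* ([(G, {})], {}, 0) c" "c = (Js, D, U)" for c Js D U
    using that
  proof (induction arbitrary: Js D U)
    case base
    have "charged k x ?n (G, {}) ?w"
      unfolding charged_def using G by (auto simp: is_instance_def defective_clique_def
          intro!: exI[of _ "{}"])
    then show ?case
      using base by (intro exI[of _ "[?w]"]) auto
  next
    case (step c c')
    obtain Is' C' T' where c: "c = (Is', C', T')"
      by (cases c)
    from step.IH[OF this] obtain ws where ws: "list_all2 (charged k x ?n) Is' ws"
      "real T' + p * sum_list ws \<le> p * ?w"
      by auto
    have "\<exists>ws'. list_all2 (charged k x ?n) Js ws' \<and>
      real U + p * sum_list ws' \<le> real T' + p * sum_list ws"
      by (rule BB_step_charged[OF x _ step.hyps(2)[unfolded c step.prems] ws(1)]) (rule cost)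
    with ws(2) show ?case
      by (meson order.trans)
  qed
  then obtain ws where ws: "list_all2 (charged k x ?n) Is ws" "real T + p * sum_list ws \<le> p * ?w"
    using reach unfolding kDCt_reaches_def by blast
  have "w \<ge> 0" if w: "w \<in> set ws" for w
  proof -
    obtain i where "i < length ws" "w = ws ! i"
      using w by (auto simp: in_set_conv_nth)
    then have "charged k x ?n (Is ! i) w"
      using ws(1) by (simp add: list_all2_conv_all_nth)
    from charged_ge_1[OF x(1) this] show ?thesis by simp
  qed
  then have "sum_list ws \<ge> 0"
    by (rule sum_list_nonneg)
  then have "0 \<le> p * sum_list ws"
    using p by simp
  then have "real T \<le> p * ?w"
    using ws(2) by simp
  also have "\<dots> \<le> 2 * x * (p * x ^ ?n)"
    using p x(2) by (simp add: charge_def open_verts_def algebra_simps)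
  finally show ?thesis .
qed

theorem theorem3p5:
  fixes k :: nat
    and cost :: "('a, 'b) inst \<Rightarrow> nat \<Rightarrow> bool"
    and P1 :: "nat \<Rightarrow> real"
  assumes "k \<ge> 1"
    and "steps_time_bound k cost P1"
    and "polynomially_bounded P1"
  shows "gamma k < 2 \<and>
    kDCt_time_in k cost (O(\<lambda>n. P1 n * gamma k ^ n)) \<and>
    kDCt_time_in k cost (Ostar (\<lambda>n. gamma k ^ n))"
proof -
  let ?x = "gamma k"
  \<comment> \<open>The absolute value supplies the nonnegative \<open>p\<close> required by
    \<open>kDCt_time_le\<close> and does not affect the class \<open>O\<close>.\<close>
  define f where "f n = 2 * ?x * (\<bar>P1 n\<bar> * ?x ^ n)" for n
  have x: "?x > 1"
    using assms(1) by (rule gamma_gt_1)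
  have time: "real T \<le> f (card (verts G))"
    if "graph G" "kDCt_reaches k cost G (Is, C, T)"
    for G :: "('a, 'b) pre_digraph" and Is C T
    unfolding f_def
  proof (rule kDCt_time_le[OF x level_weight_gamma[OF assms(1)] that(1) _ _ that(2)])
    fix I t assume "is_instance k I" "card (verts (fst I)) \<le> card (verts G)" "cost I t"
    then have "real t \<le> P1 (card (verts G))"
      using assms(2) unfolding steps_time_bound_def by (metis prod.collapse)
    then show "real t \<le> \<bar>P1 (card (verts G))\<bar>"
      by simp
  qed simp
  have f: "f \<in> O(\<lambda>n. P1 n * ?x ^ n)"
    using x by (intro bigoI[of _ "2 * ?x"]) (simp add: f_def abs_mult)
  obtain d where "P1 \<in> O(\<lambda>n. real n ^ d)"
    using assms(3) by (auto simp: polynomially_bounded_def)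
  then have "(\<lambda>n. P1 n * ?x ^ n) \<in> O(\<lambda>n. real n ^ d * ?x ^ n)"
    by (intro landau_o.big.mult) auto
  with f have "f \<in> Ostar (\<lambda>n. ?x ^ n)"
    unfolding Ostar_def using landau_o.big_trans by blast
  with f time gamma_less_2[OF assms(1)] show ?thesis
    unfolding kDCt_time_in_def by blast
qed

end
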